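(* Let $SG$ be the Sierpinski gasket, $R:SG\to SG$ the map defined in the context, and $(\mathcal E,\mathrm{dom}\,\mathcal E)$ the standard energy form on $SG$. Then for all integers $k\ge 1$ and all $u,v\in\mathrm{dom}\,\mathcal E$ one has $u\circ R^k,\ v\circ R^k\in\mathrm{dom}\,\mathcal E$ and $$\mathcal E(u\circ R^k,\,v\circ R^k)=5^k\,\mathcal E(u,v).$$
   Context: Let $z_0,z_1,z_2\in\mathbb C$ be the vertices of an equilateral triangle centered at the origin with $z_0>0$ real, $z_1=\omega z_0$, $z_2=\omega^2z_0$, where $\omega=e^{2\pi i/3}$; also write $\omega$ for the rotation $z\mapsto\omega z$. Let $F_i(z)=\frac12(z-z_i)+z_i$, $i=0,1,2$, and let $SG$ be the Sierpinski gasket, the unique nonempty compact set with $SG=\bigcup_{i=0}^2F_i(SG)$. $R:SG\to SG$ is the continuous map given by $R=F_0^{-1}$ on $F_0(SG)$, $R=\omega\circ F_1^{-1}$ on $F_1(SG)$, $R=\omega^2\circ F_2^{-1}$ on $F_2(SG)$ (these agree on intersections). It is the form taken on the standard gasket by the rational map $z^2-\frac{16}{27z}$ acting on its Julia set, which is homeomorphic to $SG$. $R^k$ is the $k$-fold iterate. Let $V_0=\{z_0,z_1,z_2\}$ and $V_{m+1}=R^{-1}(V_m)=\bigcup_{i=0}^2F_i(V_m)$. Distinct $x,y\in V_m$ are adjacent, $x\sim_m y$, if both are in $F_{i_1}\circ\cdots\circ F_{i_m}(V_0)$ for some word $i_1\cdots i_m\in\{0,1,2\}^m$. The standard energy form is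 $$\mathcal E_m(u,v)=\Big(\frac35\Big)^{-m}\sum_{x\sim_m y}(u(x)-u(y))(v(x)-v(y)),\qquad \mathcal E(u,v)=\lim_{m\to\infty}\mathcal E_m(u|_{V_m},v|_{V_m}),$$ where the sum has one term per edge. $\mathcal E_m(u,u)$ is nondecreasing in $m$ for every $u\in C(SG)$; $\mathrm{dom}\,\mathcal E=\{u\in C(SG):\mathcal E(u,u)<\infty\}$, and the limit defining $\mathcal E(u,v)$ exists for $u,v\in\mathrm{dom}\,\mathcal E$. *)

theory Defs
  imports "HOL-Analysis.Analysis"
begin

definition \<omega> :: complex where
  "\<omega> = exp (2 * of_real pi * \<i> / 3)"

text \<open>The parameter \<open>r\<close> is the positive real number \<open>z\<^sub>0\<close>.\<close>

definition vert :: "real \<Rightarrow> nat \<Rightarrow> complex" where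
  "vert r i = \<omega> ^ i * of_real r"

definition F :: "real \<Rightarrow> nat \<Rightarrow> complex \<Rightarrow> complex" where
  "F r i z = 1/2 * (z - vert r i) + vert r i"

definition is_gasket :: "real \<Rightarrow> complex set \<Rightarrow> bool" where
  "is_gasket r K \<longleftrightarrow> compact K \<and> K \<noteq> {} \<and> K = (\<Union>i\<in>{0,1,2}. F r i ` K)"

definition SG :: "real \<Rightarrow> complex set" where
  "SG r = (THE K. is_gasket r K)"

text \<open>
  \<open>R\<close> is a total function on the plane, but only its values on \<open>SG r\<close> are
  meaningful. The order of the case distinction does not matter: see \<open>R_on_cell\<close>.
\<close>

definition R :: "real \<Rightarrow> complex \<Rightarrow> complex" where
  "R r z =
    (if z \<in> F r 0 ` SG r then inv (F r 0) z
     else if z \<in> F r 1 ` SG r then \<omega> * inv (F r 1) z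
     else if z \<in> F r 2 ` SG r then \<omega>^2 * inv (F r 2) z
     else undefined)"

primrec V :: "real \<Rightarrow> nat \<Rightarrow> complex set" where
  "V r 0 = {vert r 0, vert r 1, vert r 2}"
| "V r (Suc m) = (\<Union>i\<in>{0,1,2}. F r i ` V r m)"

text \<open>The composition of the maps \<open>F r i\<close> along a word, leftmost letter outermost.\<close>

definition F_word :: "real \<Rightarrow> nat list \<Rightarrow> complex \<Rightarrow> complex" where
  "F_word r w = foldr (\<lambda>i f. F r i \<circ> f) w id"

definition adjacent :: "real \<Rightarrow> nat \<Rightarrow> complex \<Rightarrow> complex \<Rightarrow> bool" where
  "adjacent r m x y \<longleftrightarrow>
     x \<in> V r m \<and> y \<in> V r m \<and> x \<noteq> y \<and>
     (\<exists>w. length w = m \<and> set w \<subseteq> {0,1,2} \<and>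
          x \<in> F_word r w ` V r 0 \<and> y \<in> F_word r w ` V r 0)"

text \<open>
  The sum ranges over ordered pairs, so every edge is counted twice; hence the factor \<open>1/2\<close>.
  Functions on \<open>SG r\<close> are represented by functions on the plane, of which only the values
  on \<open>SG r\<close> matter.
\<close>

definition graph_energy :: "real \<Rightarrow> nat \<Rightarrow> (complex \<Rightarrow> real) \<Rightarrow> (complex \<Rightarrow> real) \<Rightarrow> real" where
  "graph_energy r m u v =
     (3/5) powi (- int m) *
     (1/2 * (\<Sum>(x, y) \<in> {(x, y). adjacent r m x y}. (u x - u y) * (v x - v y)))"

definition energy :: "real \<Rightarrow> (complex \<Rightarrow> real) \<Rightarrow> (complex \<Rightarrow> real) \<Rightarrow> real" where
  "energy r u v = lim (\<lambda>m. graph_energy r m u v)"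

text \<open>
  The limit of \<open>graph_energy r m u u\<close>, which exists in \<open>[0, \<infinity>]\<close>, is finite iff the
  sequence converges in \<open>real\<close>.
\<close>

definition dom_energy :: "real \<Rightarrow> (complex \<Rightarrow> real) set" where
  "dom_energy r = {u. continuous_on (SG r) u \<and> convergent (\<lambda>m. graph_energy r m u u)}"


subsection \<open>The gasket exists and is unique\<close>

lemma F_continuous: "continuous_on A (F r i)"
  unfolding F_def by (intro continuous_intros)

lemma F_dist: "dist (F r i x) (F r i y) = dist x y / 2"
proof -
  have "F r i x - F r i y = (1/2) * (x - y)" unfolding F_def by (simp add: field_simps)
  then show ?thesis unfolding dist_norm by (simp only: norm_mult) simp
qed

lemma F_inj: "inj (F r i)"
  unfolding inj_def F_def by auto

lemma norm_omega: "cmod \<omega> = 1"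
  unfolding \<omega>_def by (simp add: norm_exp_eq_Re)

lemma gasket_subset:
  assumes A: "is_gasket r A" and B: "is_gasket r B"
  shows "A \<subseteq> B"
proof -
  have cA: "compact A" "A \<noteq> {}" and cB: "compact B" "B \<noteq> {}"
    using A B by (auto simp: is_gasket_def)
  have eqA: "A = (\<Union>i\<in>{0,1,2}. F r i ` A)" and eqB: "B = (\<Union>i\<in>{0,1,2}. F r i ` B)"
    using A B unfolding is_gasket_def by blast+
  have "continuous_on A (\<lambda>x. infdist x B)"
    by (intro continuous_intros)
  then obtain a where a: "a \<in> A" "\<And>x. x \<in> A \<Longrightarrow> infdist x B \<le> infdist a B"
    using continuous_attains_sup[OF cA] by blast
  obtain i a' where i: "i \<in> {0,1,2}" "a' \<in> A" "a = F r i a'"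
    using a(1) eqA by blast
  obtain b where b: "b \<in> B" "infdist a' B = dist a' b"
    using infdist_attains_inf[OF compact_imp_closed[OF cB(1)] cB(2)] by blast
  have "F r i b \<in> B" using i(1) b(1) eqB by blast
  then have "infdist a B \<le> dist a (F r i b)" by (rule infdist_le)
  also have "\<dots> = infdist a' B / 2" using i(3) F_dist b(2) by simp
  also have "\<dots> \<le> infdist a B / 2" using a(2)[OF i(2)] by simp
  finally have "infdist a B = 0" using infdist_nonneg[of a B] by simp
  then have "infdist x B = 0" if "x \<in> A" for x
    using a(2)[OF that] infdist_nonneg[of x B] by simp
  then show ?thesis
    using in_closed_iff_infdist_zero[OF compact_imp_closed[OF cB(1)] cB(2)] by blast
qed

lemma gasket_exists:
  assumes "0 < r"
  shows "\<exists>K. is_gasket r K"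
proof -
  define H where "H A = (\<Union>i\<in>{0,1,2}. F r i ` A)" for A
  define K where "K n = (H ^^ n) (cball 0 r)" for n
  have H_mono: "H A \<subseteq> H B" if "A \<subseteq> B" for A B
    unfolding H_def by (intro UN_mono image_mono order_refl that)
  have K_Suc: "K (Suc n) = H (K n)" for n unfolding K_def by simp
  have F_ball: "F r i z \<in> cball 0 r" if "z \<in> cball 0 r" for i z
  proof -
    have "cmod (vert r i) = r"
      using assms by (simp add: vert_def norm_mult norm_power norm_omega)
    moreover have "F r i z = (1/2) * (z + vert r i)" by (simp add: F_def field_simps)
    then have "cmod (F r i z) = cmod (z + vert r i) / 2" by (simp only: norm_mult) simp
    moreover have "cmod (z + vert r i) \<le> cmod z + cmod (vert r i)" by (rule norm_triangle_ineq)
    ultimately show ?thesis using that by simp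
  qed
  have K_dec1: "K (Suc n) \<subseteq> K n" for n
  proof (induction n)
    case 0
    show ?case using F_ball unfolding K_def H_def by auto
  next
    case (Suc n)
    then show ?case using H_mono K_Suc by metis
  qed
  have K_dec: "m \<le> n \<Longrightarrow> K n \<subseteq> K m" for m n
    using lift_Suc_antimono_le[of K] K_dec1 by blast
  have K_compact: "compact (K n) \<and> K n \<noteq> {}" for n
  proof (induction n)
    case 0
    show ?case using assms by (auto simp: K_def)
  next
    case (Suc n)
    then show ?case unfolding K_Suc H_def
      by (auto intro!: compact_Un compact_continuous_image F_continuous)
  qed
  let ?K = "\<Inter>n. K n"
  have "?K \<noteq> {}" using compact_nest[of K] K_compact K_dec by blast
  moreover have "compact ?K"
    using K_compact compact_Inter[of "range K"] by auto
  moreover have "?K = H ?K"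
  proof
    show "H ?K \<subseteq> ?K"
    proof
      fix x assume "x \<in> H ?K"
      then have "x \<in> K (Suc n)" for n unfolding K_Suc H_def by blast
      then show "x \<in> ?K" using K_dec1 by blast
    qed
    show "?K \<subseteq> H ?K"
    proof (rule ccontr)
      assume "\<not> ?K \<subseteq> H ?K"
      then obtain x where x: "x \<in> ?K" "x \<notin> H ?K" by blast
      have "\<exists>n. x \<notin> F r i ` K n" if "i \<in> {0,1,2}" for i
      proof (rule ccontr)
        assume "\<nexists>n. x \<notin> F r i ` K n"
        then have "x \<in> (\<Inter>n. F r i ` K n)" by blast
        also have "\<dots> = F r i ` ?K"
          using image_INT[of "F r i" UNIV UNIV K] F_inj[of r i] by auto
        finally show False using x(2) that unfolding H_def by blast
      qed
      then obtain N where N: "\<And>i. i \<in> {0,1,2} \<Longrightarrow> x \<notin> F r i ` K (N i)" by metis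
      let ?n = "max (N 0) (max (N 1) (N 2))"
      have "x \<notin> F r i ` K ?n" if "i \<in> {0,1,2}" for i
      proof -
        have "N i \<le> ?n" using that by auto
        then show ?thesis using N[OF that] K_dec by blast
      qed
      then have "x \<notin> K (Suc ?n)" unfolding K_Suc H_def by blast
      then show False using x(1) by blast
    qed
  qed
  ultimately show ?thesis unfolding is_gasket_def H_def by blast
qed

lemma gasket_unique:
  assumes "0 < r"
  shows "\<exists>!K. is_gasket r K"
  using gasket_exists[OF assms] gasket_subset by blast

lemma SG_gasket:
  assumes "0 < r"
  shows "is_gasket r (SG r)"
  unfolding SG_def by (rule theI'[OF gasket_unique[OF assms]])


subsection \<open>The branches of \<open>R\<close> agree on intersections\<close>

lemma omega_cart: "\<omega> = Complex (- 1/2) (sqrt 3 / 2)"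
proof -
  have "\<omega> = cis (2 * pi / 3)"
    unfolding \<omega>_def cis_conv_exp by (simp add: mult.commute mult.left_commute)
  moreover have "cos (2 * pi / 3) = - 1/2" "sin (2 * pi / 3) = sqrt 3 / 2"
    using cos_120 sin_120 by simp_all
  ultimately show ?thesis by (simp add: complex_eq_iff)
qed

lemma omega_square: "\<omega>^2 = Complex (- 1/2) (- sqrt 3 / 2)"
  unfolding omega_cart power2_eq_square by (simp add: complex_eq_iff)

lemma SG_halfplane:
  assumes r: "0 < r"
    and vert: "\<And>i. i \<in> {0,1,2} \<Longrightarrow> a * Re (vert r i) + b * Im (vert r i) \<ge> c"
    and z: "z \<in> SG r"
  shows "a * Re z + b * Im z \<ge> c"
proof -
  have SG: "compact (SG r)" "SG r \<noteq> {}" and eq: "SG r = (\<Union>i\<in>{0,1,2}. F r i ` SG r)"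
    using SG_gasket[OF r] unfolding is_gasket_def by blast+
  have "continuous_on (SG r) (\<lambda>z. a * Re z + b * Im z)"
    by (intro continuous_intros)
  then obtain x where x: "x \<in> SG r"
    "\<And>y. y \<in> SG r \<Longrightarrow> a * Re x + b * Im x \<le> a * Re y + b * Im y"
    using continuous_attains_inf[OF SG] by blast
  obtain i y where i: "i \<in> {0,1,2}" "y \<in> SG r" "x = F r i y" using x(1) eq by blast
  have "x = (y + vert r i) / 2" using i(3) by (simp add: F_def field_simps)
  then have "a * Re x + b * Im x =
    ((a * Re y + b * Im y) + (a * Re (vert r i) + b * Im (vert r i))) / 2"
    by (simp add: algebra_simps add_divide_distrib)
  then have "a * Re x + b * Im x \<ge> c" using vert[OF i(1)] x(2)[OF i(2)] by argo
  then show ?thesis using x(2)[OF z] by argo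
qed

lemma vert_cart:
  "vert r 0 = Complex r 0"
  "vert r (Suc 0) = Complex (- r / 2) (sqrt 3 / 2 * r)"
  "vert r 2 = Complex (- r / 2) (- (sqrt 3 / 2) * r)"
  unfolding vert_def omega_square by (simp_all add: omega_cart complex_eq_iff)

lemma SG_triangle:
  assumes "0 < r" "z \<in> SG r"
  shows "Re z \<ge> - r / 2" "- Re z + sqrt 3 * Im z \<ge> - r" "- Re z - sqrt 3 * Im z \<ge> - r"
proof -
  have [simp]: "sqrt 3 * (sqrt 3 * x) = 3 * x" for x :: real
    by (metis mult.assoc real_sqrt_mult_self abs_numeral)
  show "Re z \<ge> - r / 2"
    using SG_halfplane[OF assms(1) _ assms(2), of "- r / 2" 1 0] assms(1) by (force simp: vert_cart)
  show "- Re z + sqrt 3 * Im z \<ge> - r"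
    using SG_halfplane[OF assms(1) _ assms(2), of "- r" "- 1" "sqrt 3"] assms(1) by (force simp: vert_cart)
  show "- Re z - sqrt 3 * Im z \<ge> - r"
    using SG_halfplane[OF assms(1) _ assms(2), of "- r" "- 1" "- sqrt 3"] assms(1) by (force simp: vert_cart)
qed

lemma cells_meet:
  assumes r: "0 < r" and ij: "i \<in> {0,1,2}" "j \<in> {0,1,2}" "i \<noteq> j"
    and ab: "a \<in> SG r" "b \<in> SG r" and eq: "F r i a = F r j b"
  shows "a = vert r j \<and> b = vert r i"
proof -
  have 1: "a + vert r i = b + vert r j" 
  proof -
    have "(a + vert r i) / 2 = (b + vert r j) / 2"
      using eq by (simp add: F_def field_simps)
    then show ?thesis by (metis divide_cancel_right zero_neq_numeral)
  qed
  define s where "s = sqrt (3::real)"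
  have s: "s > 0" "s * s = 3" "\<And>x. s * (s * x) = 3 * x"
    by (simp_all add: s_def flip: mult.assoc)
  have re: "Re a + Re (vert r i) = Re b + Re (vert r j)"
    and im: "s * Im a + s * Im (vert r i) = s * Im b + s * Im (vert r j)"
    using arg_cong[OF 1, of Re] arg_cong[OF 1, of "\<lambda>z. s * Im z"] by (auto simp: algebra_simps)
  have v: "s * Im (vert r 0) = 0" "s * Im (vert r (Suc 0)) = 3/2 * r"
    "s * Im (vert r 2) = - 3/2 * r"
    using s(2) by (simp_all add: vert_cart s_def)
  have t: "Re a \<ge> - r / 2" "- Re a + s * Im a \<ge> - r" "- Re a - s * Im a \<ge> - r"
    "Re b \<ge> - r / 2" "- Re b + s * Im b \<ge> - r" "- Re b - s * Im b \<ge> - r"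
    using SG_triangle[OF r] ab by (simp_all add: s_def)
  have w: "Re (vert r 0) = r" "Re (vert r (Suc 0)) = - r / 2" "Re (vert r 2) = - r / 2"
    by (simp_all add: vert_cart)
  have "Re a = Re (vert r j) \<and> s * Im a = s * Im (vert r j) \<and>
        Re b = Re (vert r i) \<and> s * Im b = s * Im (vert r i)"
  proof -
    consider "i = 0" "j = Suc 0" | "i = 0" "j = 2" | "i = Suc 0" "j = 0"
      | "i = Suc 0" "j = 2" | "i = 2" "j = 0" | "i = 2" "j = Suc 0"
      using ij by auto
    then show ?thesis
      by cases (use re im t v w in \<open>hypsubst, intro conjI; linarith\<close>)+
  qed
  then show ?thesis using s(1) by (simp add: complex_eq_iff)
qed

lemma R_on_cell:
  assumes r: "0 < r" and i: "i \<in> {0,1,2}" and z: "z \<in> F r i ` SG r"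
  shows "R r z = \<omega> ^ i * inv (F r i) z"
proof -
  have agree: "\<omega> ^ j * inv (F r j) z = \<omega> ^ i * inv (F r i) z"
    if j: "j \<in> {0,1,2}" and zj: "z \<in> F r j ` SG r" for j
  proof (cases "j = i")
    case False
    obtain a b where ab: "a \<in> SG r" "b \<in> SG r" "z = F r i a" "z = F r j b"
      using z zj by blast
    then have "a = vert r j" "b = vert r i"
      using cells_meet[OF r i j] False by auto
    moreover have "inv (F r i) z = a" "inv (F r j) z = b"
      using ab(3,4) F_inj inv_f_f by metis+
    ultimately show ?thesis by (simp add: vert_def mult.left_commute)
  qed simp
  show ?thesis
    using agree[of 0] agree[of 1] agree[of 2] i z unfolding R_def by auto
qed

end

theory Submission
  imports Defs
begin

text \<open>
  Both ingredients of the theorem are exact already at finite level. The edges of level \<open>m + 1\<close>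
  are the disjoint union of the images under \<open>F r 0\<close>, \<open>F r 1\<close>, \<open>F r 2\<close> of the edges of level \<open>m\<close>,
  because two cells share only one point; hence the graph energy of level \<open>m + 1\<close> of \<open>f\<close> is
  \<open>5/3\<close> times the sum of the graph energies of level \<open>m\<close> of the three \<open>f \<circ> F r i\<close>
  (lemma \<open>graph_energy_Suc\<close>). For \<open>f = u \<circ> R r\<close> the function \<open>f \<circ> F r i\<close> is \<open>u\<close> composed with the
  rotation by \<open>\<omega> ^ i\<close>, and the graph energy is invariant under rotations
  (lemma \<open>graph_energy_rotate\<close>). So the three summands are equal, and
  \<open>graph_energy r (Suc m) (u \<circ> R r) (v \<circ> R r) = 5 * graph_energy r m u v\<close>
  (lemma \<open>graph_energy_R\<close>). The theorem follows by letting \<open>m\<close> tend to infinity and by induction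
  on the number of iterations.

  Since \<open>lim\<close> is meaningful only for convergent sequences, passing to the limit requires that
  \<open>graph_energy r m u v\<close> converges for \<open>u\<close> and \<open>v\<close> of finite energy. By polarization this is a
  statement about quadratic energies, which are nondecreasing in the level: for levels \<open>0\<close> and
  \<open>1\<close> the increment is an explicit sum of squares, and self-similarity carries the inequality to
  all levels.
\<close>

section \<open>Rotations of the gasket\<close>

lemma omega_cube: "\<omega> ^ 3 = 1"
proof -
  have "\<omega> ^ 3 = exp (of_nat 3 * (2 * of_real pi * \<i> / 3))"
    unfolding \<omega>_def by (rule exp_of_nat_mult[symmetric])
  also have "\<dots> = 1" by (simp add: exp_eq_1)
  finally show ?thesis .
qed

lemma vert_rotate: "\<omega> * vert r i = vert r (Suc i)"
  by (simp add: vert_def)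

lemma vert_3: "vert r 3 = vert r 0"
  unfolding vert_def omega_cube by simp

lemma F_rotate: "\<omega> * F r i z = F r (Suc i) (\<omega> * z)"
  unfolding F_def vert_rotate[symmetric] by (simp add: field_simps)

lemma F_3: "F r 3 = F r 0"
  unfolding F_def vert_3 by simp

lemma F_vert_self: "F r i (vert r i) = vert r i"
  by (simp add: F_def)

lemma F_vert_swap: "F r i (vert r j) = F r j (vert r i)"
  by (simp add: F_def field_simps)

lemma SG_props:
  assumes "0 < r"
  shows "compact (SG r)" "SG r \<noteq> {}" "SG r = (\<Union>i\<in>{0,1,2}. F r i ` SG r)"
  using SG_gasket[OF assms] unfolding is_gasket_def by blast+

lemma F_in_SG: "0 < r \<Longrightarrow> i \<in> {0,1,2} \<Longrightarrow> z \<in> SG r \<Longrightarrow> F r i z \<in> SG r"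
  using SG_props(3)[of r] by blast

text \<open>The rotated gasket satisfies the same fixed-point equation, with the three maps permuted.\<close>

lemma SG_rotate:
  assumes r: "0 < r" and z: "z \<in> SG r"
  shows "\<omega> * z \<in> SG r"
proof -
  let ?K = "(*) \<omega> ` SG r"
  have "SG r = F r 0 ` SG r \<union> F r 1 ` SG r \<union> F r 2 ` SG r"
    by (subst SG_props(3)[OF r]) (simp add: Un_assoc)
  then have "?K = (*) \<omega> ` (F r 0 ` SG r \<union> F r 1 ` SG r \<union> F r 2 ` SG r)"
    by (rule arg_cong)
  also have "\<dots> = F r 1 ` ?K \<union> F r 2 ` ?K \<union> F r 3 ` ?K"
    by (simp add: image_Un image_image F_rotate numeral_2_eq_2 numeral_3_eq_3)
  also have "\<dots> = (\<Union>i\<in>{0,1,2}. F r i ` ?K)"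
    unfolding F_3 by auto
  finally have "?K = (\<Union>i\<in>{0,1,2}. F r i ` ?K)" .
  moreover have "compact ?K"
    using SG_props(1)[OF r] by (intro compact_continuous_image continuous_intros)
  moreover have "?K \<noteq> {}" using SG_props(2)[OF r] by simp
  ultimately have "is_gasket r ?K" unfolding is_gasket_def by blast
  then have "?K \<subseteq> SG r" by (rule gasket_subset[OF _ SG_gasket[OF r]])
  then show ?thesis using z by blast
qed

lemma SG_rotate_power: "0 < r \<Longrightarrow> z \<in> SG r \<Longrightarrow> \<omega> ^ i * z \<in> SG r"
  by (induction i) (auto simp: SG_rotate mult.assoc)

text \<open>
  A point of the gasket closest to the fixed point of \<open>F r i\<close> must be that fixed point, since
  \<open>F r i\<close> halves its distance.
\<close>

lemma vert_in_SG:
  assumes r: "0 < r" and i: "i \<in> {0,1,2}"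
  shows "vert r i \<in> SG r"
proof -
  have cl: "closed (SG r)" using SG_props(1)[OF r] by (rule compact_imp_closed)
  obtain b where b: "b \<in> SG r" "infdist (vert r i) (SG r) = dist (vert r i) b"
    using infdist_attains_inf[OF cl SG_props(2)[OF r]] by blast
  have "infdist (vert r i) (SG r) \<le> dist (F r i (vert r i)) (F r i b)"
    unfolding F_vert_self by (rule infdist_le[OF F_in_SG[OF r i b(1)]])
  then have "dist (vert r i) b = 0" using b(2) F_dist by simp
  then show ?thesis using b(1) by simp
qed

lemma V_subset_SG:
  assumes r: "0 < r"
  shows "V r m \<subseteq> SG r"
proof (induction m)
  case 0
  show ?case using vert_in_SG[OF r] by simp
next
  case (Suc m)
  then show ?case using F_in_SG[OF r] unfolding V.simps by blast
qed

section \<open>Self-similarity of the edges and of the graph energy\<close>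

definition edges :: "real \<Rightarrow> nat \<Rightarrow> (complex \<times> complex) set" where
  "edges r m = {(x, y). adjacent r m x y}"

lemma edgesD: "(x, y) \<in> edges r m \<Longrightarrow> x \<in> V r m \<and> y \<in> V r m \<and> x \<noteq> y"
  by (simp add: edges_def adjacent_def)

lemma F_word_in_V: "set w \<subseteq> {0,1,2} \<Longrightarrow> p \<in> V r 0 \<Longrightarrow> F_word r w p \<in> V r (length w)"
proof (induction w)
  case Nil
  then show ?case by (simp add: F_word_def)
next
  case (Cons i w)
  then have "F_word r w p \<in> V r (length w)" by simp
  moreover have "F_word r (i # w) p = F r i (F_word r w p)" by (simp add: F_word_def)
  ultimately show ?case using Cons.prems(1) by auto
qed

lemma adjacent_Suc:
  "adjacent r (Suc m) x y \<longleftrightarrow>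
    (\<exists>i\<in>{0,1,2}. \<exists>x' y'. adjacent r m x' y' \<and> x = F r i x' \<and> y = F r i y')"
proof
  assume "adjacent r (Suc m) x y"
  then obtain w p q where w: "length w = Suc m" "set w \<subseteq> {0,1,2}"
    and pq: "p \<in> V r 0" "q \<in> V r 0" "x = F_word r w p" "y = F_word r w q" and "x \<noteq> y"
    unfolding adjacent_def by blast
  obtain i w' where w': "w = i # w'" using w(1) by (cases w) auto
  then have m: "length w' = m" "set w' \<subseteq> {0,1,2}" "i \<in> {0,1,2}" using w by auto
  have xy: "x = F r i (F_word r w' p)" "y = F r i (F_word r w' q)"
    using pq w' by (simp_all add: F_word_def)
  have "adjacent r m (F_word r w' p) (F_word r w' q)"
    unfolding adjacent_def using F_word_in_V[OF m(2)] m pq(1,2) xy \<open>x \<noteq> y\<close>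
    by (intro conjI exI[of _ w']) auto
  then show "\<exists>i\<in>{0,1,2}. \<exists>x' y'. adjacent r m x' y' \<and> x = F r i x' \<and> y = F r i y'"
    using xy m(3) by blast
next
  assume "\<exists>i\<in>{0,1,2}. \<exists>x' y'. adjacent r m x' y' \<and> x = F r i x' \<and> y = F r i y'"
  then obtain i x' y' where i: "i \<in> {0,1,2}" and a: "adjacent r m x' y'"
    and xy: "x = F r i x'" "y = F r i y'" by blast
  obtain w where w: "length w = m" "set w \<subseteq> {0,1,2}"
    "x' \<in> F_word r w ` V r 0" "y' \<in> F_word r w ` V r 0"
    using a unfolding adjacent_def by blast
  have img: "F r i z \<in> F_word r (i # w) ` V r 0" if "z \<in> F_word r w ` V r 0" for z
    using that by (auto simp: F_word_def)
  have "x \<noteq> y" using a xy F_inj[of r i] unfolding adjacent_def inj_def by blast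
  moreover have "x \<in> V r (Suc m)" "y \<in> V r (Suc m)"
    using a i xy unfolding adjacent_def V.simps by (auto simp del: One_nat_def)
  moreover have "length (i # w) = Suc m" "set (i # w) \<subseteq> {0,1,2}" using w i by auto
  ultimately show "adjacent r (Suc m) x y"
    unfolding adjacent_def using img[OF w(3)] img[OF w(4)] xy
    by (intro conjI exI[of _ "i # w"]) simp_all
qed

lemma edges_Suc: "edges r (Suc m) = (\<Union>i\<in>{0,1,2}. map_prod (F r i) (F r i) ` edges r m)"
proof (rule set_eqI)
  fix e :: "complex \<times> complex"
  obtain x y where e: "e = (x, y)" by (cases e)
  have img: "(x, y) \<in> map_prod (F r i) (F r i) ` edges r m \<longleftrightarrow>
      (\<exists>x' y'. adjacent r m x' y' \<and> x = F r i x' \<and> y = F r i y')" for i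
    unfolding edges_def by auto
  have "(x, y) \<in> edges r (Suc m) \<longleftrightarrow> adjacent r (Suc m) x y"
    by (simp add: edges_def)
  then show "e \<in> edges r (Suc m) \<longleftrightarrow>
      e \<in> (\<Union>i\<in>{0,1,2}. map_prod (F r i) (F r i) ` edges r m)"
    unfolding e UN_iff img adjacent_Suc .
qed

lemma finite_edges: "finite (edges r m)"
proof -
  have "finite (V r m)" by (induction m) auto
  moreover have "edges r m \<subseteq> V r m \<times> V r m" using edgesD by auto
  ultimately show ?thesis by (meson finite_SigmaI finite_subset)
qed

text \<open>An edge in two cells would have both its end points at their only common point.\<close>

lemma edges_cells_disjoint:
  assumes r: "0 < r" and ij: "i \<in> {0,1,2}" "j \<in> {0,1,2}" "i \<noteq> j"
  shows "map_prod (F r i) (F r i) ` edges r m \<inter> map_prod (F r j) (F r j) ` edges r m = {}"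
proof (rule Int_emptyI)
  fix e
  assume "e \<in> map_prod (F r i) (F r i) ` edges r m" "e \<in> map_prod (F r j) (F r j) ` edges r m"
  then obtain p q where pq: "p \<in> edges r m" "q \<in> edges r m"
    and eq': "map_prod (F r i) (F r i) p = map_prod (F r j) (F r j) q"
    by (elim imageE) simp
  obtain a b a' b' where p: "p = (a, b)" and q: "q = (a', b')" by (cases p, cases q)
  have e: "(a, b) \<in> edges r m" "(a', b') \<in> edges r m" using pq p q by simp_all
  have eq: "F r i a = F r j a'" "F r i b = F r j b'" using eq' p q by simp_all
  have SG: "a \<in> SG r" "b \<in> SG r" "a' \<in> SG r" "b' \<in> SG r" and "a \<noteq> b"
    using edgesD[OF e(1)] edgesD[OF e(2)] V_subset_SG[OF r, of m] by blast+
  have "a = vert r j" "b = vert r j"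
    using cells_meet[OF r ij SG(1,3) eq(1)] cells_meet[OF r ij SG(2,4) eq(2)] by auto
  then show False using \<open>a \<noteq> b\<close> by simp
qed

lemma graph_energy_edges:
  "graph_energy r m u v =
    (5/3) ^ m * (1/2 * (\<Sum>(x, y) \<in> edges r m. (u x - u y) * (v x - v y)))"
  unfolding graph_energy_def edges_def
  by (simp add: power_int_minus flip: power_inverse)

lemma graph_energy_cong:
  assumes "\<And>x. x \<in> V r m \<Longrightarrow> u x = u' x" "\<And>x. x \<in> V r m \<Longrightarrow> v x = v' x"
  shows "graph_energy r m u v = graph_energy r m u' v'"
proof -
  have "(\<Sum>(x, y) \<in> edges r m. (u x - u y) * (v x - v y)) =
        (\<Sum>(x, y) \<in> edges r m. (u' x - u' y) * (v' x - v' y))"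
    by (rule sum.cong) (auto dest!: edgesD simp: assms)
  then show ?thesis by (simp add: graph_energy_edges)
qed

lemma graph_energy_Suc:
  assumes r: "0 < r"
  shows "graph_energy r (Suc m) u v =
    5/3 * (\<Sum>i\<in>{0,1,2}. graph_energy r m (u \<circ> F r i) (v \<circ> F r i))"
proof -
  let ?g = "\<lambda>(x, y). (u x - u y) * (v x - v y)"
  have "sum ?g (edges r (Suc m)) =
      (\<Sum>i\<in>{0,1,2}. sum ?g (map_prod (F r i) (F r i) ` edges r m))"
    unfolding edges_Suc
    by (intro sum.UNION_disjoint ballI impI edges_cells_disjoint[OF r] finite_imageI finite_edges)
       auto
  also have "\<dots> = (\<Sum>i\<in>{0,1,2}. \<Sum>(x, y) \<in> edges r m.
      (u (F r i x) - u (F r i y)) * (v (F r i x) - v (F r i y)))"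
  proof (rule sum.cong[OF refl])
    fix i
    have "inj_on (map_prod (F r i) (F r i)) (edges r m)"
      using map_prod_inj_on[OF F_inj F_inj, of r i r i] by (rule inj_on_subset) simp
    then show "sum ?g (map_prod (F r i) (F r i) ` edges r m) = (\<Sum>(x, y) \<in> edges r m.
        (u (F r i x) - u (F r i y)) * (v (F r i x) - v (F r i y)))"
      by (simp add: sum.reindex case_prod_unfold)
  qed
  finally show ?thesis
    by (simp add: graph_energy_edges sum_distrib_left algebra_simps)
qed

lemma vert_distinct:
  assumes "0 < r"
  shows "vert r 0 \<noteq> vert r 1" "vert r 1 \<noteq> vert r 2" "vert r 0 \<noteq> vert r 2"
  using assms by (auto simp: vert_cart complex_eq_iff)

lemma graph_energy_0:
  assumes r: "0 < r"
  shows "graph_energy r 0 u v =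
    (u (vert r 0) - u (vert r 1)) * (v (vert r 0) - v (vert r 1)) +
    (u (vert r 1) - u (vert r 2)) * (v (vert r 1) - v (vert r 2)) +
    (u (vert r 2) - u (vert r 0)) * (v (vert r 2) - v (vert r 0))"
proof -
  define a b c where abc: "a = vert r 0" "b = vert r 1" "c = vert r 2"
  have ne: "a \<noteq> b" "b \<noteq> c" "a \<noteq> c" "b \<noteq> a" "c \<noteq> b" "c \<noteq> a"
    using vert_distinct[OF r] abc by auto
  have "edges r 0 = {(a,b), (b,a), (b,c), (c,b), (c,a), (a,c)}"
    unfolding edges_def adjacent_def F_word_def V.simps abc[symmetric] using ne by auto
  then show ?thesis
    unfolding graph_energy_edges abc[symmetric] using ne by (simp add: algebra_simps)
qed

text \<open>
  A rotation permutes the corners, which gives level \<open>0\<close>; it also permutes the cells, up to the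
  same rotation inside each of them, which gives the induction step.
\<close>

lemma graph_energy_rotate:
  assumes r: "0 < r"
  shows "graph_energy r m (u \<circ> (*) \<omega>) (v \<circ> (*) \<omega>) = graph_energy r m u v"
proof (induction m arbitrary: u v)
  case 0
  have "\<omega> * vert r 0 = vert r 1" "\<omega> * vert r 1 = vert r 2" "\<omega> * vert r 2 = vert r 0"
    using vert_rotate[of r 0] vert_rotate[of r 1] vert_rotate[of r 2] vert_3
    by (simp_all add: numeral_2_eq_2 numeral_3_eq_3)
  then show ?case by (simp add: graph_energy_0[OF r])
next
  case (Suc m)
  define E where "E i = graph_energy r m (u \<circ> F r i) (v \<circ> F r i)" for i
  have comp: "f \<circ> (*) \<omega> \<circ> F r i = (f \<circ> F r (Suc i)) \<circ> (*) \<omega>" for f :: "complex \<Rightarrow> real" and i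
    by (simp add: fun_eq_iff F_rotate)
  have "graph_energy r (Suc m) (u \<circ> (*) \<omega>) (v \<circ> (*) \<omega>) = 5/3 * (\<Sum>i\<in>{0,1,2}. E (Suc i))"
    unfolding graph_energy_Suc[OF r] comp Suc.IH E_def ..
  also have "\<dots> = 5/3 * (\<Sum>i\<in>{0,1,2}. E i)"
    using F_3[of r] by (simp add: E_def numeral_2_eq_2 numeral_3_eq_3)
  finally show ?case unfolding graph_energy_Suc[OF r] E_def .
qed

lemma graph_energy_rotate_power:
  assumes r: "0 < r"
  shows "graph_energy r m (u \<circ> (*) (\<omega> ^ i)) (v \<circ> (*) (\<omega> ^ i)) = graph_energy r m u v"
proof (induction i)
  case 0
  have "(*) (1::complex) = id" by auto
  then show ?case by simp
next
  case (Suc i)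
  have "f \<circ> (*) (\<omega> ^ Suc i) = (f \<circ> (*) (\<omega> ^ i)) \<circ> (*) \<omega>" for f :: "complex \<Rightarrow> real"
    by (simp add: fun_eq_iff mult_ac)
  then show ?case using Suc by (simp only: graph_energy_rotate[OF r])
qed

section \<open>Convergence of the mutual energy\<close>

text \<open>
  For fixed values \<open>a, b, c\<close> at the corners, the energy of level \<open>1\<close> is least when the values at
  the midpoints are \<open>(2 * a + 2 * b + c) / 5\<close> and its cyclic analogues. Completing the squares
  around this minimum, whose value is the energy of level \<open>0\<close>, gives the increment.
\<close>

lemma harmonic_extension_ineq:
  fixes a b c x y z :: real
  shows "(a - b)\<^sup>2 + (b - c)\<^sup>2 + (c - a)\<^sup>2 \<le>
    5/3 * (((a - x)\<^sup>2 + (x - z)\<^sup>2 + (z - a)\<^sup>2) + ((x - b)\<^sup>2 + (b - y)\<^sup>2 + (y - x)\<^sup>2) +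
      ((z - y)\<^sup>2 + (y - c)\<^sup>2 + (c - z)\<^sup>2))"
    (is "?D \<le> ?S")
proof -
  define p q s where "p = x - (2 * a + 2 * b + c) / 5" "q = y - (2 * b + 2 * c + a) / 5"
    "s = z - (2 * c + 2 * a + b) / 5"
  then have "?S = ?D + 5/3 * (2 * (p\<^sup>2 + q\<^sup>2 + s\<^sup>2) + (p - q)\<^sup>2 + (q - s)\<^sup>2 + (s - p)\<^sup>2)"
    unfolding power2_eq_square
    by (simp only:) (simp add: add_divide_distrib diff_divide_distrib algebra_simps)
  then show ?thesis by simp
qed

lemma graph_energy_le_Suc:
  assumes r: "0 < r"
  shows "graph_energy r m u u \<le> graph_energy r (Suc m) u u"
proof (induction m arbitrary: u)
  case 0
  have swap: "F r 1 (vert r 0) = F r 0 (vert r 1)" "F r 2 (vert r 0) = F r 0 (vert r 2)"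
    "F r 2 (vert r 1) = F r 1 (vert r 2)" by (rule F_vert_swap)+
  let ?a = "u (vert r 0)" and ?b = "u (vert r 1)" and ?c = "u (vert r 2)"
  let ?x = "u (F r 0 (vert r 1))" and ?y = "u (F r 1 (vert r 2))" and ?z = "u (F r 0 (vert r 2))"
  have "graph_energy r 0 u u = (?a - ?b)\<^sup>2 + (?b - ?c)\<^sup>2 + (?c - ?a)\<^sup>2"
    unfolding graph_energy_0[OF r] power2_eq_square ..
  also have "\<dots> \<le> 5/3 *
      (((?a - ?x)\<^sup>2 + (?x - ?z)\<^sup>2 + (?z - ?a)\<^sup>2) + ((?x - ?b)\<^sup>2 + (?b - ?y)\<^sup>2 + (?y - ?x)\<^sup>2) +
        ((?z - ?y)\<^sup>2 + (?y - ?c)\<^sup>2 + (?c - ?z)\<^sup>2))"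
    by (rule harmonic_extension_ineq)
  also have "\<dots> = graph_energy r (Suc 0) u u"
    unfolding graph_energy_Suc[OF r] graph_energy_0[OF r] power2_eq_square
    by (simp add: F_vert_self swap[simplified] del: distrib_left_numeral distrib_right_numeral)
  finally show ?case .
next
  case (Suc m)
  have "5/3 * (\<Sum>i\<in>{0,1,2}. graph_energy r m (u \<circ> F r i) (u \<circ> F r i)) \<le>
        5/3 * (\<Sum>i\<in>{0,1,2}. graph_energy r (Suc m) (u \<circ> F r i) (u \<circ> F r i))"
    by (intro mult_left_mono sum_mono Suc.IH) simp
  then show ?case unfolding graph_energy_Suc[OF r, of m] graph_energy_Suc[OF r, of "Suc m"] .
qed

lemma graph_energy_nonneg: "0 \<le> graph_energy r m u u"
  unfolding graph_energy_edges by (intro mult_nonneg_nonneg sum_nonneg) auto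

lemma graph_energy_lincomb:
  "graph_energy r m (\<lambda>x. u x + c * v x) (\<lambda>x. u x + c * v x) =
    graph_energy r m u u + 2 * c * graph_energy r m u v + c\<^sup>2 * graph_energy r m v v"
proof -
  let ?S = "\<lambda>f g. \<Sum>(x, y) \<in> edges r m. (f x - f y) * (g x - g y)"
  let ?w = "\<lambda>x. u x + c * v x"
  have "?S ?w ?w = ?S u u + 2 * c * ?S u v + c\<^sup>2 * ?S v v"
    unfolding sum_distrib_left sum.distrib[symmetric]
    by (rule sum.cong) (auto simp: algebra_simps power2_eq_square)
  then show ?thesis by (simp add: graph_energy_edges algebra_simps)
qed

text \<open>
  By polarization it suffices to treat the quadratic energy of \<open>u + v\<close>, which is nondecreasing in
  the level and, since that of \<open>u - v\<close> is nonnegative, at most twice the sum of those of \<open>u\<close>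
  and \<open>v\<close>.
\<close>

lemma graph_energy_convergent:
  assumes r: "0 < r" and u: "u \<in> dom_energy r" and v: "v \<in> dom_energy r"
  shows "convergent (\<lambda>m. graph_energy r m u v)"
proof -
  define Q where "Q m = graph_energy r m (\<lambda>x. u x + v x) (\<lambda>x. u x + v x)" for m
  have cu: "convergent (\<lambda>m. graph_energy r m u u)" and cv: "convergent (\<lambda>m. graph_energy r m v v)"
    using u v by (auto simp: dom_energy_def)
  have Q_eq: "Q m = graph_energy r m u u + 2 * graph_energy r m u v + graph_energy r m v v" for m
    using graph_energy_lincomb[of r m u 1 v] by (simp add: Q_def)
  have Q_le: "Q m \<le> 2 * (graph_energy r m u u + graph_energy r m v v)" for m
    using graph_energy_nonneg[of r m "\<lambda>x. u x + (-1) * v x"]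
    unfolding graph_energy_lincomb Q_eq by simp
  have "convergent (\<lambda>m. 2 * (graph_energy r m u u + graph_energy r m v v))"
    by (intro convergent_mult convergent_add convergent_const cu cv)
  then obtain B where B: "\<And>m. norm (2 * (graph_energy r m u u + graph_energy r m v v)) \<le> B"
    using BseqE[OF convergent_imp_Bseq] by blast
  have "norm (Q m) \<le> B" for m
    using Q_le[of m] B[of m] graph_energy_nonneg[of r m "\<lambda>x. u x + v x"] by (simp add: Q_def)
  then have "Bseq Q" by (rule BseqI')
  moreover have "incseq Q"
    unfolding Q_def by (intro incseq_SucI graph_energy_le_Suc[OF r])
  ultimately have "convergent Q"
    using Bseq_mono_convergent[of Q] by (simp add: incseq_def)
  then have "convergent (\<lambda>m. (Q m - graph_energy r m u u - graph_energy r m v v) * (1/2))"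
    by (intro convergent_mult convergent_diff convergent_const cu cv)
  then show ?thesis by (simp add: Q_eq)
qed

section \<open>Composition with the map\<close>

lemma R_F:
  assumes "0 < r" "i \<in> {0,1,2}" "z \<in> SG r"
  shows "R r (F r i z) = \<omega> ^ i * z"
  using R_on_cell[OF assms(1,2), of "F r i z"] assms(3) F_inj[of r i] by simp

lemma graph_energy_R:
  assumes r: "0 < r"
  shows "graph_energy r (Suc m) (u \<circ> R r) (v \<circ> R r) = 5 * graph_energy r m u v"
proof -
  have "graph_energy r m (u \<circ> R r \<circ> F r i) (v \<circ> R r \<circ> F r i) = graph_energy r m u v"
    if i: "i \<in> {0,1,2}" for i
  proof -
    have eq: "(f \<circ> R r \<circ> F r i) x = (f \<circ> (*) (\<omega> ^ i)) x" if "x \<in> V r m"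
      for f :: "complex \<Rightarrow> real" and x
      using R_F[OF r i subsetD[OF V_subset_SG[OF r] that]] by simp
    have "graph_energy r m (u \<circ> R r \<circ> F r i) (v \<circ> R r \<circ> F r i) =
        graph_energy r m (u \<circ> (*) (\<omega> ^ i)) (v \<circ> (*) (\<omega> ^ i))"
      by (rule graph_energy_cong; rule eq)
    then show ?thesis using graph_energy_rotate_power[OF r] by simp
  qed
  then show ?thesis unfolding graph_energy_Suc[OF r] by simp
qed

text \<open>On each of the three closed cells the map is affine, so the pasting lemma applies.\<close>

lemma continuous_on_comp_R:
  assumes r: "0 < r" and u: "continuous_on (SG r) u"
  shows "continuous_on (SG r) (u \<circ> R r)"
proof -
  have inv: "inv (F r i) z = 2 * z - vert r i" for i z
    by (rule inv_f_eq[OF F_inj]) (simp add: F_def field_simps)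
  have cell: "continuous_on (F r i ` SG r) (u \<circ> R r)" if i: "i \<in> {0,1,2}" for i
  proof -
    have "continuous_on (F r i ` SG r) (\<lambda>z. \<omega> ^ i * (2 * z - vert r i))"
      by (intro continuous_intros)
    moreover have "R r z = \<omega> ^ i * (2 * z - vert r i)" if "z \<in> F r i ` SG r" for z
      using R_on_cell[OF r i that] inv by simp
    ultimately have "continuous_on (F r i ` SG r) (R r)"
      by (simp cong: continuous_on_cong)
    moreover have "R r ` F r i ` SG r \<subseteq> SG r"
      using R_F[OF r i] SG_rotate_power[OF r] by auto
    ultimately show ?thesis
      using continuous_on_compose continuous_on_subset[OF u] by blast
  qed
  have "continuous_on (\<Union>i\<in>{0,1,2}. F r i ` SG r) (u \<circ> R r)"
    using cell SG_props(1)[OF r] F_continuous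
    by (intro continuous_on_closed_Union compact_imp_closed compact_continuous_image) auto
  then show ?thesis by (simp only: SG_props(3)[OF r, symmetric])
qed

lemma dom_energy_comp_R:
  assumes r: "0 < r" and u: "u \<in> dom_energy r"
  shows "u \<circ> R r \<in> dom_energy r"
proof -
  have "convergent (\<lambda>m. 5 * graph_energy r m u u)"
    using u by (intro convergent_mult convergent_const) (simp add: dom_energy_def)
  then have "convergent (\<lambda>m. graph_energy r (Suc m) (u \<circ> R r) (u \<circ> R r))"
    unfolding graph_energy_R[OF r] .
  then have "convergent (\<lambda>m. graph_energy r m (u \<circ> R r) (u \<circ> R r))"
    by (rule iffD1[OF convergent_Suc_iff])
  moreover have "continuous_on (SG r) (u \<circ> R r)"
    using u by (intro continuous_on_comp_R[OF r]) (simp add: dom_energy_def)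
  ultimately show ?thesis by (simp add: dom_energy_def)
qed

lemma energy_comp_R:
  assumes r: "0 < r" and u: "u \<in> dom_energy r" and v: "v \<in> dom_energy r"
  shows "energy r (u \<circ> R r) (v \<circ> R r) = 5 * energy r u v"
proof -
  have "(\<lambda>m. graph_energy r m u v) \<longlonglongrightarrow> energy r u v"
    using graph_energy_convergent[OF r u v] unfolding energy_def convergent_LIMSEQ_iff .
  then have "(\<lambda>m. 5 * graph_energy r m u v) \<longlonglongrightarrow> 5 * energy r u v"
    by (rule tendsto_mult_left)
  then have "(\<lambda>m. graph_energy r (Suc m) (u \<circ> R r) (v \<circ> R r)) \<longlonglongrightarrow> 5 * energy r u v"
    unfolding graph_energy_R[OF r] .
  then have "(\<lambda>m. graph_energy r m (u \<circ> R r) (v \<circ> R r)) \<longlonglongrightarrow> 5 * energy r u v"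
    by (rule LIMSEQ_imp_Suc)
  then show ?thesis unfolding energy_def[of r "u \<circ> R r"] by (rule limI)
qed

lemma comp_funpow_Suc: "f \<circ> (g ^^ Suc k) = (f \<circ> (g ^^ k)) \<circ> g"
  by (simp add: fun_eq_iff funpow_swap1)

lemma dom_energy_comp_R_power:
  "0 < r \<Longrightarrow> u \<in> dom_energy r \<Longrightarrow> u \<circ> (R r ^^ k) \<in> dom_energy r"
proof (induction k)
  case (Suc k)
  show ?case
    unfolding comp_funpow_Suc by (rule dom_energy_comp_R[OF Suc.prems(1) Suc.IH[OF Suc.prems]])
qed simp

theorem mainTheorem3:
  fixes r :: real and k :: nat and u v :: "complex \<Rightarrow> real"
  assumes "0 < r" and "1 \<le> k"
    and "u \<in> dom_energy r" and "v \<in> dom_energy r"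
  shows "u \<circ> (R r ^^ k) \<in> dom_energy r \<and> v \<circ> (R r ^^ k) \<in> dom_energy r \<and>
    energy r (u \<circ> (R r ^^ k)) (v \<circ> (R r ^^ k)) = 5 ^ k * energy r u v"
proof -
  have "energy r (u \<circ> (R r ^^ n)) (v \<circ> (R r ^^ n)) = 5 ^ n * energy r u v" for n
  proof (induction n)
    case (Suc n)
    have "energy r (u \<circ> (R r ^^ Suc n)) (v \<circ> (R r ^^ Suc n)) =
        5 * energy r (u \<circ> (R r ^^ n)) (v \<circ> (R r ^^ n))"
      unfolding comp_funpow_Suc
      by (intro energy_comp_R dom_energy_comp_R_power assms)
    then show ?case unfolding Suc by (simp only: power_Suc mult.assoc)
  qed simp
  then show ?thesis using dom_energy_comp_R_power assms by blast
qed

end
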